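(* Let $N\ge 1$, let $\mathbf{V}=(V_1,\dots,V_N)$ be an innately regular collection of closed linear subspaces of a real Hilbert space $H$, and let $\eta\in(0,1]$. Let $x_0\in H$ with $x_0\neq 0$, let $(i_n)_{n\ge 0}$ be any sequence in $\{1,\dots,N\}$ and $(\lambda_n)_{n\ge 0}$ any sequence in $[\eta,2-\eta]$, and let $(x_n)_{n\ge0}$ be defined by $x_{n+1}:=P_{i_n,\lambda_n}(x_n)$, $n\ge0$. Put $\delta_n:=\frac{\|x_{n+1}-x_n\|}{(2-\eta)\|x_0\|}$ for $n\ge 0$, and let $(\delta_n^* )_{n\ge0}$ be the decreasing rearrangement of $(\delta_n)_{n\ge0}$, i.e. the (unique) sequence $\delta_0^*\ge\delta_1^*\ge\cdots$ satisfying $\delta_n^*=\delta_{\pi(n)}$ for some bijection $\pi:\mathbb{N}\to\mathbb{N}$, where $\mathbb{N}=\{0,1,2,\dots\}$. Then $$\delta^*_n < c_* \exp(-\rho_* n^{1/N})\quad\text{for all } n\ge 0,$$ where $\rho_*:=\frac{N}{9}\log\beta_*^{-1}>0$ and $c_*:=\beta_*^{-N}$, with $\beta_*=\beta_*(\mathbf{V},\eta)$ the constant defined in the context.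
   Context: For $1\le i\le N$, $P_i$ denotes the orthogonal projection of $H$ onto $V_i$, and for $\lambda\in[0,2]$ its relaxation is $P_{i,\lambda}(x):=(1-\lambda)x+\lambda P_i(x)$. For a closed subspace $V$, $d(x,V)$ denotes the distance from $x$ to $V$. A finite collection $(W_1,\dots,W_m)$ of closed subspaces is regular if there is $\kappa<\infty$ with $d(x,W_1\cap\dots\cap W_m)\le\kappa\max_i d(x,W_i)$ for all $x\in H$; $\mathbf{V}$ is innately regular if every nonempty subcollection is regular. The angle $\varphi(V,W)\in[0,\frac{\pi}{2}]$ between closed subspaces $V,W$ is defined by $$\cos\varphi(V,W)=\sup\{|\langle v,w\rangle| : v\in V\cap(V\cap W)^\perp,\ w\in W\cap(V\cap W)^\perp,\ \|v\|\le1,\ \|w\|\le1\}$$ (so nested subspaces have angle $\pi/2$). For $I\subset[N]:=\{1,\dots,N\}$ let $V_I:=\bigcap_{i\in I}V_i$, with $V_\emptyset:=H$. It is known that innate regularity of $\mathbf{V}$ is equivalent to $\varphi(V_I,V_J)>0$ for all $I,J\subset[N]$. Define $$\kappa_*:=\max_{I,J\subset[N]}\frac{2}{\sin\varphi(V_I,V_J)},\qquad \varepsilon_*:=\tfrac12\kappa_*^{-N},\qquad \beta_*:=\left(1-\eta(2-\eta)\varepsilon_*^2\right)^{1/2}.$$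
   Formalization: The decreasing rearrangement is taken with π injective and covering all n with δ_n ≠ 0, instead of π bijective: if δ has infinitely many positive terms and some zero term, no bijective decreasing rearrangement exists; where one exists, the two agree. *)

theory Defs
  imports "HOL-Analysis.Analysis"
begin

text \<open>
  A real Hilbert space is a type of class \<open>{real_inner, complete_space}\<close>.
  A collection \<open>(V\<^sub>1, \<dots>, V\<^sub>N)\<close> of subspaces is a function \<open>V\<close> on \<open>nat\<close> of which only the
  values at \<open>{1..N}\<close> matter.  The intersection \<open>V\<^sub>I\<close> is written \<open>\<Inter>i\<in>I. V i\<close>; for
  empty \<open>I\<close> it is \<open>UNIV\<close>, as wanted.
\<close>

text \<open>
  The library's \<open>closest_point\<close> requires class \<open>heine_borel\<close>, hence finite dimension.
\<close>

definition orth_proj :: "'a::real_inner set \<Rightarrow> 'a \<Rightarrow> 'a" where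
  "orth_proj V x = (THE p. p \<in> V \<and> x - p \<in> orthogonal_comp V)"

definition relaxed_proj :: "'a::real_inner set \<Rightarrow> real \<Rightarrow> 'a \<Rightarrow> 'a" where
  "relaxed_proj V lam x = (1 - lam) *\<^sub>R x + lam *\<^sub>R orth_proj V x"

definition regular_on :: "'i set \<Rightarrow> ('i \<Rightarrow> 'a::real_inner set) \<Rightarrow> bool" where
  "regular_on I V \<longleftrightarrow>
     (\<exists>\<kappa>. \<forall>x. infdist x (\<Inter>i\<in>I. V i) \<le> \<kappa> * (MAX i\<in>I. infdist x (V i)))"

definition innately_regular :: "nat \<Rightarrow> (nat \<Rightarrow> 'a::real_inner set) \<Rightarrow> bool" where
  "innately_regular N V \<longleftrightarrow> (\<forall>I. I \<subseteq> {1..N} \<and> I \<noteq> {} \<longrightarrow> regular_on I V)"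

text \<open>
  The supremum is over a nonempty set of reals bounded by \<open>1\<close>, so the angle lies in
  \<open>[0, pi/2]\<close>.
\<close>

definition subspace_angle :: "'a::real_inner set \<Rightarrow> 'a set \<Rightarrow> real" where
  "subspace_angle V W =
     arccos (Sup {\<bar>v \<bullet> w\<bar> | v w.
       v \<in> V \<inter> orthogonal_comp (V \<inter> W) \<and> w \<in> W \<inter> orthogonal_comp (V \<inter> W) \<and>
       norm v \<le> 1 \<and> norm w \<le> 1})"

definition kappa_star :: "nat \<Rightarrow> (nat \<Rightarrow> 'a::real_inner set) \<Rightarrow> real" where
  "kappa_star N V =
     Max {2 / sin (subspace_angle (\<Inter>i\<in>I. V i) (\<Inter>j\<in>J. V j)) | I J.
       I \<subseteq> {1..N} \<and> J \<subseteq> {1..N}}"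

definition eps_star :: "nat \<Rightarrow> (nat \<Rightarrow> 'a::real_inner set) \<Rightarrow> real" where
  "eps_star N V = 1/2 * kappa_star N V powi (- int N)"

definition beta_star :: "nat \<Rightarrow> (nat \<Rightarrow> 'a::real_inner set) \<Rightarrow> real \<Rightarrow> real" where
  "beta_star N V \<eta> = sqrt (1 - \<eta> * (2 - \<eta>) * (eps_star N V)\<^sup>2)"

definition rho_star :: "nat \<Rightarrow> (nat \<Rightarrow> 'a::real_inner set) \<Rightarrow> real \<Rightarrow> real" where
  "rho_star N V \<eta> = real N / 9 * ln (inverse (beta_star N V \<eta>))"

definition c_star :: "nat \<Rightarrow> (nat \<Rightarrow> 'a::real_inner set) \<Rightarrow> real \<Rightarrow> real" where
  "c_star N V \<eta> = beta_star N V \<eta> powi (- int N)"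

text \<open>
  Decreasing rearrangement of a sequence of nonnegative reals.  If \<open>d\<close> has infinitely many
  positive terms and also a zero term, then no decreasing sequence has the form \<open>d \<circ> \<pi>\<close>
  with \<open>\<pi>\<close> a bijection of \<open>nat\<close>: the zero would have to be preceded by all the positive
  terms.  In that case, as usual, zero terms may be left out, so \<open>\<pi>\<close> is only required to be
  injective and to reach all nonzero terms.  Whenever a rearrangement by a bijection does
  exist it is the decreasing rearrangement, see \<open>decreasing_rearrangement_bij\<close>.
\<close>

definition is_decreasing_rearrangement :: "(nat \<Rightarrow> real) \<Rightarrow> (nat \<Rightarrow> real) \<Rightarrow> bool" where
  "is_decreasing_rearrangement d s \<longleftrightarrow>
     decseq s \<and> (\<exists>\<pi>. inj \<pi> \<and> {k. d k \<noteq> 0} \<subseteq> range \<pi> \<and> (\<forall>n. s n = d (\<pi> n)))"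

definition decreasing_rearrangement :: "(nat \<Rightarrow> real) \<Rightarrow> nat \<Rightarrow> real" where
  "decreasing_rearrangement d = (THE s. is_decreasing_rearrangement d s)"

lemma is_decreasing_rearrangement_le:
  assumes d: "\<And>k. 0 \<le> d k"
    and s: "is_decreasing_rearrangement d s" and t: "is_decreasing_rearrangement d t"
  shows "t n \<le> s n"
proof (rule ccontr)
  assume "\<not> t n \<le> s n"
  then have lt: "s n < t n" by simp
  from s obtain \<pi> where \<pi>: "decseq s" "{k. d k \<noteq> 0} \<subseteq> range \<pi>" "\<And>m. s m = d (\<pi> m)"
    unfolding is_decreasing_rearrangement_def by auto
  from t obtain \<sigma> where \<sigma>: "decseq t" "inj \<sigma>" "\<And>m. t m = d (\<sigma> m)"
    unfolding is_decreasing_rearrangement_def by auto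
  have "\<sigma> ` {..n} \<subseteq> \<pi> ` {..<n}"
  proof
    fix k assume "k \<in> \<sigma> ` {..n}"
    then have k: "s n < d k"
      using \<sigma>(1,3) lt by (auto dest!: decseqD[of t])
    with d[of "\<pi> n"] \<pi>(3)[of n] have "d k \<noteq> 0" by auto
    with \<pi>(2) obtain m where m: "k = \<pi> m" by blast
    have "m < n"
      using k m \<pi>(3) decseqD[OF \<pi>(1), of n m] by (metis not_le)
    with m show "k \<in> \<pi> ` {..<n}" by auto
  qed
  then have "card (\<sigma> ` {..n}) \<le> card (\<pi> ` {..<n})" by (intro card_mono) auto
  also have "\<dots> \<le> n" using card_image_le[of "{..<n}" \<pi>] by simp
  finally show False
    using \<sigma>(2) by (simp add: card_image inj_on_subset)
qed

lemma decreasing_rearrangement_eqI: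
  assumes "\<And>k. 0 \<le> d k" and "is_decreasing_rearrangement d s"
  shows "decreasing_rearrangement d = s"
  unfolding decreasing_rearrangement_def
  using assms by (intro the_equality ext order_antisym is_decreasing_rearrangement_le)

lemma decreasing_rearrangement_bij:
  assumes "\<And>k. 0 \<le> d k" and "decseq s" and "bij \<pi>" and "\<And>n. s n = d (\<pi> n)"
  shows "decreasing_rearrangement d = s"
proof (rule decreasing_rearrangement_eqI)
  have "inj \<pi>" and "range \<pi> = UNIV" using assms(3) by (simp_all add: bij_def)
  then show "is_decreasing_rearrangement d s"
    unfolding is_decreasing_rearrangement_def using assms by blast
qed (fact assms(1))

end

theory Submission
  imports Defs
begin

text \<open>
  Every relaxed projection onto a space \<open>V\<close> containing a subspace \<open>W\<close> lowers the squared distance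
  to \<open>W\<close> by at least \<open>\<eta> (2 - \<eta>)\<close> times the squared distance to \<open>V\<close>
  (\<open>infdist_relaxed_proj_power2_le\<close>).  A step is \<^emph>\<open>large\<close> if the current point has distance at least
  \<open>t\<close> from the space that is used.  A summation of these losses bounds the number of large steps
  only polynomially in \<open>1/t\<close>; regularity turns this into a power of the logarithm of \<open>1/t\<close>.

  Let \<open>J\<close> contain the indices that are used, let \<open>D\<close> be the distance to the intersection \<open>V\<^sub>J\<close>, which
  never increases, and cut the sequence at the first step that takes \<open>D\<close> below \<open>\<beta>\<close> times its initial
  value \<open>D\<^sub>0\<close>.  Before the cut every step starts at distance at most \<open>\<epsilon> D\<^sub>0\<close> from the space it uses,
  since otherwise it would itself bring \<open>D\<close> below \<open>\<beta> D\<^sub>0\<close>.  Regularity makes such smallness add up: the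
  point stays within \<open>\<kappa>\<^sup>m \<epsilon> D\<^sub>0\<close> of the intersection of the \<open>m\<close> spaces used so far
  (\<open>infdist_used_spaces_le\<close>).  As \<open>\<kappa>\<^sup>N \<epsilon> = 1/2 \<le> \<beta>\<close>, the steps before the cut cannot use all indices of
  \<open>J\<close>.  So the part before the cut has fewer spaces, and the part after it starts closer by a
  factor \<open>\<beta>\<close>.  With \<open>G(m, k)\<close> a bound for the number of large steps when \<open>m\<close> spaces are available and
  \<open>\<beta>\<^sup>k D\<^sub>0 < t\<close>, this is \<open>G(m, k) \<le> G(m - 1, k) + 1 + G(m, k - 1)\<close>, the recursion of Pascal's triangle
  for \<open>G + 1\<close>.  Hence fewer than \<open>(N + k) choose k\<close> steps are large
  (\<open>card_large_steps_less_binomial\<close>).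

  The binomial coefficient is at most \<open>(3 (N + k) / N)\<^sup>N\<close>.  Solving for \<open>k\<close> as a function of the position
  \<open>n\<close> in the decreasing rearrangement gives the stretched exponential (\<open>power_less_stretched_exp\<close>).

  The constants come from angles: \<open>2 / sin \<phi>(V, W)\<close> bounds the distance to \<open>V \<inter> W\<close> by the larger of
  the distances to \<open>V\<close> and \<open>W\<close> (\<open>sin_subspace_angle_times_infdist_le\<close>), and conversely a bound of
  this kind keeps the angle away from zero (\<open>sin_subspace_angle_pos\<close>).
\<close>

section \<open>Orthogonal projections in a Hilbert space\<close>

text \<open>
  The points of \<open>V\<close> that are almost closest to \<open>x\<close> form nested closed sets, whose diameters tend
  to zero by the parallelogram law; completeness provides a common point.  A closest point is an
  orthogonal projection because no multiple of a \<open>v \<in> V\<close> improves it.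
\<close>

lemma exists_orthogonal_projection:
  fixes V :: "'a::{real_inner, complete_space} set"
  assumes "subspace V" and "closed V"
  obtains p where "p \<in> V" and "x - p \<in> orthogonal_comp V"
proof -
  define d where "d = infdist x V"
  define S where "S n = V \<inter> cball x (sqrt (d\<^sup>2 + inverse (real (Suc n))))" for n
  have ne: "V \<noteq> {}" using subspace_0[OF assms(1)] by auto
  have d0: "0 \<le> d" unfolding d_def by (rule infdist_nonneg)
  have dle: "d \<le> norm (x - v)" if "v \<in> V" for v
    using infdist_le[OF that, of x] by (simp add: d_def dist_norm)
  have "\<And>n. closed (S n)" unfolding S_def using assms(2) by auto
  moreover have "S n \<noteq> {}" for n
  proof -
    have "d < sqrt (d\<^sup>2 + inverse (real (Suc n)))"
      by (rule real_less_rsqrt) simp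
    then have "\<exists>v\<in>V. dist x v < sqrt (d\<^sup>2 + inverse (real (Suc n)))"
      unfolding d_def infdist_notempty[OF ne] using ne
      by (subst (asm) cINF_less_iff) (auto intro!: bdd_belowI2[where m = 0])
    then show ?thesis unfolding S_def by force
  qed
  moreover have "S n \<subseteq> S m" if "m \<le> n" for m n
  proof -
    have "inverse (real (Suc n)) \<le> inverse (real (Suc m))" using that by simp
    then have "sqrt (d\<^sup>2 + inverse (real (Suc n))) \<le> sqrt (d\<^sup>2 + inverse (real (Suc m)))"
      by simp
    then show ?thesis unfolding S_def by (intro Int_mono subset_cball) auto
  qed
  \<comment> \<open>By the parallelogram law two points of \<open>S n\<close> have squared distance at most
      \<open>4 / (n + 1)\<close>, as their midpoint is in \<open>V\<close>.\<close>
  moreover have "\<exists>n. \<forall>u\<in>S n. \<forall>v\<in>S n. dist u v < e" if e: "e > 0" for e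
  proof -
    obtain n where n: "inverse (real (Suc n)) < e\<^sup>2 / 4"
      using reals_Archimedean[of "e\<^sup>2 / 4"] e by auto
    have "dist u v < e" if uv: "u \<in> S n" "v \<in> S n" for u v
    proof -
      have sq: "(norm (x - w))\<^sup>2 \<le> d\<^sup>2 + inverse (real (Suc n))" if "w \<in> S n" for w
      proof -
        have "norm (x - w) \<le> sqrt (d\<^sup>2 + inverse (real (Suc n)))"
          using that by (simp add: S_def dist_norm)
        then have "(norm (x - w))\<^sup>2 \<le> (sqrt (d\<^sup>2 + inverse (real (Suc n))))\<^sup>2"
          by (intro power_mono) auto
        then show ?thesis by simp
      qed
      have "(1/2) *\<^sub>R (u + v) \<in> V"
        using uv assms(1) by (simp add: S_def subspace_add subspace_scale)
      from dle[OF this] have "d\<^sup>2 \<le> (norm (x - (1/2) *\<^sub>R (u + v)))\<^sup>2"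
        using d0 by (intro power_mono) auto
      moreover have "(norm (u - v))\<^sup>2 = 2 * (norm (x - u))\<^sup>2 + 2 * (norm (x - v))\<^sup>2
          - 4 * (norm (x - (1/2) *\<^sub>R (u + v)))\<^sup>2"
        by (simp add: power2_norm_eq_inner algebra_simps inner_commute)
      ultimately have "(norm (u - v))\<^sup>2 < e\<^sup>2" using sq[OF uv(1)] sq[OF uv(2)] n by linarith
      then show ?thesis using e by (simp add: dist_norm power_less_imp_less_base)
    qed
    then show ?thesis by blast
  qed
  ultimately have "\<exists>p. \<forall>n. p \<in> S n"
    using decreasing_closed_nest[of S] by metis
  then obtain p where p: "\<And>n. p \<in> S n" by blast
  then have pV: "p \<in> V" by (simp add: S_def)
  have "(norm (x - p))\<^sup>2 \<le> d\<^sup>2 + inverse (real (Suc n))" for n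
  proof -
    have "norm (x - p) \<le> sqrt (d\<^sup>2 + inverse (real (Suc n)))"
      using p[of n] by (simp add: S_def dist_norm)
    then have "(norm (x - p))\<^sup>2 \<le> (sqrt (d\<^sup>2 + inverse (real (Suc n))))\<^sup>2"
      by (intro power_mono) auto
    then show ?thesis by simp
  qed
  then have pd: "(norm (x - p))\<^sup>2 \<le> d\<^sup>2"
    by (meson field_le_epsilon less_imp_le reals_Archimedean order_trans add_left_mono)
  have "v \<bullet> (x - p) = 0" if v: "v \<in> V" for v
  proof (cases "v = 0")
    case False
    \<comment> \<open>The multiple of \<open>v\<close> that is best for approximating \<open>x - p\<close>.\<close>
    define t where "t = (x - p) \<bullet> v / (v \<bullet> v)"
    have "p + t *\<^sub>R v \<in> V" using pV v assms(1) by (simp add: subspace_add subspace_scale)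
    from dle[OF this] have "d\<^sup>2 \<le> (norm (x - (p + t *\<^sub>R v)))\<^sup>2"
      using d0 by (intro power_mono) auto
    also have "\<dots> = (norm (x - p))\<^sup>2 - 2 * t * ((x - p) \<bullet> v) + t\<^sup>2 * (v \<bullet> v)"
      unfolding power2_norm_eq_inner
      by (simp add: algebra_simps inner_commute power2_eq_square)
    also have "\<dots> = (norm (x - p))\<^sup>2 - ((x - p) \<bullet> v)\<^sup>2 / (v \<bullet> v)"
      using False by (simp add: t_def power2_eq_square)
    finally have "((x - p) \<bullet> v)\<^sup>2 / (v \<bullet> v) \<le> 0" using pd by linarith
    moreover have "0 < v \<bullet> v" using False by simp
    ultimately show ?thesis
      by (simp add: divide_le_0_iff inner_commute)
  qed simp
  then show thesis using that[OF pV] by (simp add: orthogonal_comp_def orthogonal_def)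
qed

lemma
  fixes V :: "'a::{real_inner, complete_space} set"
  assumes "subspace V" and "closed V"
  shows orth_proj_mem: "orth_proj V x \<in> V"
    and orth_proj_orthogonal: "v \<in> V \<Longrightarrow> (x - orth_proj V x) \<bullet> v = 0"
proof -
  obtain p where p: "p \<in> V" "x - p \<in> orthogonal_comp V"
    using exists_orthogonal_projection[OF assms] .
  have "q = p" if q: "q \<in> V" "x - q \<in> orthogonal_comp V" for q
  proof -
    have "q - p \<in> V" using assms(1) p(1) q(1) by (simp add: subspace_diff)
    then have "(q - p) \<bullet> (x - p) = 0" "(q - p) \<bullet> (x - q) = 0"
      using p(2) q(2) by (auto simp: orthogonal_comp_def orthogonal_def)
    then have "(q - p) \<bullet> (q - p) = 0" by (simp add: inner_diff_right)
    then show ?thesis by simp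
  qed
  with p have eq: "orth_proj V x = p" unfolding orth_proj_def by (intro the_equality) blast+
  show "orth_proj V x \<in> V" using p(1) by (simp only: eq)
  show "(x - orth_proj V x) \<bullet> v = 0" if "v \<in> V"
    using p(2) that unfolding eq
    by (simp add: orthogonal_comp_def orthogonal_def inner_commute[of _ v])
qed

lemma infdist_eq_norm_minus_orth_proj:
  fixes V :: "'a::{real_inner, complete_space} set"
  assumes "subspace V" and "closed V"
  shows "infdist x V = norm (x - orth_proj V x)"
proof (rule antisym)
  show "infdist x V \<le> norm (x - orth_proj V x)"
    using infdist_le[OF orth_proj_mem[OF assms], of x x] by (simp add: dist_norm)
  have ne: "V \<noteq> {}" using subspace_0[OF assms(1)] by auto
  show "norm (x - orth_proj V x) \<le> infdist x V"
    unfolding infdist_notempty[OF ne]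
  proof (rule cINF_greatest[OF ne])
    fix v assume v: "v \<in> V"
    let ?p = "orth_proj V x"
    have "?p - v \<in> V" using v orth_proj_mem[OF assms] assms(1) by (simp add: subspace_diff)
    then have "(x - ?p) \<bullet> (?p - v) = 0" using orth_proj_orthogonal[OF assms] by blast
    then have "(norm ((x - ?p) + (?p - v)))\<^sup>2 = (norm (x - ?p))\<^sup>2 + (norm (?p - v))\<^sup>2"
      by (intro norm_add_Pythagorean) (simp add: orthogonal_def)
    then have "(norm (x - ?p))\<^sup>2 \<le> (norm (x - v))\<^sup>2" by simp
    then show "norm (x - ?p) \<le> dist x v" by (simp add: dist_norm)
  qed
qed

text \<open>
  Write \<open>p\<close> and \<open>w\<close> for the projections of \<open>x\<close> onto \<open>V\<close> and \<open>W\<close>.  The step moves \<open>x\<close> along \<open>x - p\<close>,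
  which is orthogonal to \<open>p - w \<in> V\<close>; so \<open>(x - p) \<bullet> (x - w) = (norm (x - p))\<^sup>2\<close>, and the new squared
  distance to \<open>w\<close> is an explicit quadratic in \<open>lam\<close>.
\<close>

lemma infdist_relaxed_proj_power2_le:
  fixes V W :: "'a::{real_inner, complete_space} set"
  assumes V: "subspace V" "closed V" and W: "subspace W" "closed W" and "W \<subseteq> V"
  shows "(infdist (relaxed_proj V lam x) W)\<^sup>2
    \<le> (infdist x W)\<^sup>2 - lam * (2 - lam) * (infdist x V)\<^sup>2"
proof -
  let ?p = "orth_proj V x" and ?w = "orth_proj W x"
  have "?p - ?w \<in> V"
    using orth_proj_mem[OF V] orth_proj_mem[OF W] assms(5) V(1) by (blast intro: subspace_diff)
  then have *: "(x - ?p) \<bullet> (?p - ?w) = 0" using orth_proj_orthogonal[OF V] by blast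
  have "infdist (relaxed_proj V lam x) W \<le> norm ((x - ?w) - lam *\<^sub>R (x - ?p))"
    using infdist_le[OF orth_proj_mem[OF W, of x], of "relaxed_proj V lam x"]
    by (simp add: dist_norm relaxed_proj_def algebra_simps)
  then have "(infdist (relaxed_proj V lam x) W)\<^sup>2 \<le> (norm ((x - ?w) - lam *\<^sub>R (x - ?p)))\<^sup>2"
    by (intro power_mono infdist_nonneg)
  also have "\<dots> = (norm (x - ?w))\<^sup>2 - 2 * lam * ((x - ?p) \<bullet> (x - ?w)) + lam\<^sup>2 * (norm (x - ?p))\<^sup>2"
    unfolding power2_norm_eq_inner by (simp add: algebra_simps inner_commute power2_eq_square)
  also have "(x - ?p) \<bullet> (x - ?w) = (norm (x - ?p))\<^sup>2"
    using * unfolding power2_norm_eq_inner by (simp add: algebra_simps)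
  finally show ?thesis
    unfolding infdist_eq_norm_minus_orth_proj[OF V] infdist_eq_norm_minus_orth_proj[OF W]
    by (simp add: algebra_simps power2_eq_square)
qed

lemma infdist_relaxed_proj_le:
  fixes V W :: "'a::{real_inner, complete_space} set"
  assumes "subspace V" "closed V" "subspace W" "closed W" "W \<subseteq> V" and "lam \<in> {0..2}"
  shows "infdist (relaxed_proj V lam x) W \<le> infdist x W"
proof -
  have "0 \<le> lam * (2 - lam) * (infdist x V)\<^sup>2" using assms(6) by simp
  then have "(infdist (relaxed_proj V lam x) W)\<^sup>2 \<le> (infdist x W)\<^sup>2"
    using infdist_relaxed_proj_power2_le[OF assms(1-5), of lam x] by linarith
  then show ?thesis by (rule power2_le_imp_le) (rule infdist_nonneg)
qed

lemma norm_relaxed_proj_diff: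
  fixes V :: "'a::{real_inner, complete_space} set"
  assumes "subspace V" and "closed V"
  shows "norm (relaxed_proj V lam x - x) = \<bar>lam\<bar> * infdist x V"
proof -
  have "relaxed_proj V lam x - x = - (lam *\<^sub>R (x - orth_proj V x))"
    by (simp add: relaxed_proj_def scaleR_diff_left scaleR_diff_right)
  then show ?thesis by (simp add: infdist_eq_norm_minus_orth_proj[OF assms])
qed

section \<open>Angles and distances\<close>

text \<open>
  These four facts determine the angle: its cosine is the least constant in a strengthened
  Cauchy-Schwarz inequality between the two subspaces, taken modulo their intersection.
\<close>

lemma
  fixes A B :: "'a::real_inner set"
  assumes "subspace A" and "subspace B"
  shows cos_subspace_angle_nonneg: "0 \<le> cos (subspace_angle A B)"
    and sin_subspace_angle_nonneg: "0 \<le> sin (subspace_angle A B)"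
    and abs_inner_le_cos_subspace_angle:
      "a \<in> A \<inter> orthogonal_comp (A \<inter> B) \<Longrightarrow> b \<in> B \<inter> orthogonal_comp (A \<inter> B)
        \<Longrightarrow> \<bar>a \<bullet> b\<bar> \<le> cos (subspace_angle A B) * (norm a * norm b)"
    and cos_subspace_angle_le:
      "(\<And>a b. a \<in> A \<inter> orthogonal_comp (A \<inter> B) \<Longrightarrow> b \<in> B \<inter> orthogonal_comp (A \<inter> B)
           \<Longrightarrow> norm a \<le> 1 \<Longrightarrow> norm b \<le> 1 \<Longrightarrow> \<bar>a \<bullet> b\<bar> \<le> K) \<Longrightarrow> cos (subspace_angle A B) \<le> K"
proof -
  let ?C = "orthogonal_comp (A \<inter> B)"
  define S where "S = {\<bar>v \<bullet> w\<bar> | v w. v \<in> A \<inter> ?C \<and> w \<in> B \<inter> ?C \<and> norm v \<le> 1 \<and> norm w \<le> 1}"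
  have le1: "s \<le> 1" if s: "s \<in> S" for s
  proof -
    obtain v w :: 'a where "s = \<bar>v \<bullet> w\<bar>" "norm v \<le> 1" "norm w \<le> 1"
      using s unfolding S_def by blast
    then show ?thesis
      using Cauchy_Schwarz_ineq2[of v w] mult_mono[of "norm v" 1 "norm w" 1] by simp
  qed
  have C: "subspace ?C" by (rule subspace_orthogonal_comp)
  have 0: "0 \<in> S"
    unfolding S_def using subspace_0[OF assms(1)] subspace_0[OF assms(2)] subspace_0[OF C]
    by (intro CollectI exI[of _ 0] conjI) auto
  have bdd: "bdd_above S" using le1 by (rule bdd_aboveI)
  have Sup0: "0 \<le> Sup S" by (rule cSup_upper[OF 0 bdd])
  have Sup1: "Sup S \<le> 1" using 0 le1 by (intro cSup_least) auto
  have angle: "subspace_angle A B = arccos (Sup S)" by (simp add: subspace_angle_def S_def)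
  have cos: "cos (subspace_angle A B) = Sup S"
    unfolding angle using Sup0 Sup1 by (intro cos_arccos) auto
  show "0 \<le> cos (subspace_angle A B)" using Sup0 cos by simp
  show "0 \<le> sin (subspace_angle A B)"
    unfolding angle using Sup0 Sup1 by (intro sin_ge_zero arccos_lbound arccos_ubound) auto
  show "\<bar>a \<bullet> b\<bar> \<le> cos (subspace_angle A B) * (norm a * norm b)"
    if a: "a \<in> A \<inter> ?C" and b: "b \<in> B \<inter> ?C"
  proof (cases "a = 0 \<or> b = 0")
    case False
    then have pos: "norm a > 0" "norm b > 0" by auto
    have "\<bar>(inverse (norm a) *\<^sub>R a) \<bullet> (inverse (norm b) *\<^sub>R b)\<bar> \<in> S"
      unfolding S_def using a b pos assms C
      by (intro CollectI exI[of _ "inverse (norm a) *\<^sub>R a"] exI[of _ "inverse (norm b) *\<^sub>R b"])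
        (auto simp: subspace_scale)
    then have "\<bar>(inverse (norm a) *\<^sub>R a) \<bullet> (inverse (norm b) *\<^sub>R b)\<bar> \<le> Sup S"
      by (rule cSup_upper[OF _ bdd])
    then show ?thesis unfolding cos using pos by (simp add: abs_mult field_simps)
  qed auto
  show "cos (subspace_angle A B) \<le> K" if K: "\<And>a b. a \<in> A \<inter> ?C \<Longrightarrow> b \<in> B \<inter> ?C
         \<Longrightarrow> norm a \<le> 1 \<Longrightarrow> norm b \<le> 1 \<Longrightarrow> \<bar>a \<bullet> b\<bar> \<le> K"
    unfolding cos
  proof (rule cSup_least)
    show "S \<noteq> {}" using 0 by auto
    show "s \<le> K" if "s \<in> S" for s using that K unfolding S_def by blast
  qed
qed

text \<open>
  A vector that is almost in both subspaces but orthogonal to their intersection would make its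
  two projections nearly parallel, which the angle forbids.  The factor \<open>2\<close> is the one in
  \<open>sin \<phi> \<le> 2 sin (\<phi>/2)\<close>: the worst vector lies in the middle between the subspaces.
\<close>

lemma sin_subspace_angle_times_infdist_le:
  fixes A B :: "'a::{real_inner, complete_space} set"
  assumes A: "subspace A" "closed A" and B: "subspace B" "closed B"
  shows "sin (subspace_angle A B) * infdist x (A \<inter> B) \<le> 2 * max (infdist x A) (infdist x B)"
proof -
  define c where "c = cos (subspace_angle A B)"
  have c: "0 \<le> c" "c \<le> 1"
    unfolding c_def by (simp_all add: cos_subspace_angle_nonneg[OF A(1) B(1)])
  have C: "subspace (A \<inter> B)" "closed (A \<inter> B)" using A B by (auto intro: subspace_inter)
  define z where "z = orth_proj (A \<inter> B) x"
  define y where "y = x - z"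
  define d where "d = max (infdist x A) (infdist x B)"
  have zC: "z \<in> A \<inter> B" unfolding z_def by (rule orth_proj_mem[OF C])
  have yC: "y \<bullet> v = 0" if "v \<in> A \<inter> B" for v
    unfolding y_def z_def by (rule orth_proj_orthogonal[OF C that])
  \<comment> \<open>The component of \<open>x\<close> in \<open>A \<inter> B\<close> does not change any of the distances, so \<open>x\<close> may be
      replaced by \<open>y\<close>; for \<open>U\<close> one of the two subspaces, the projection \<open>a\<close> of \<open>y\<close> onto \<open>U\<close> is a test
      vector for the angle.\<close>
  have proj: "\<exists>a. a \<in> U \<inter> orthogonal_comp (A \<inter> B) \<and> y \<bullet> a = a \<bullet> a \<and> infdist x U = norm (y - a)"
    if U: "subspace U" "closed U" and sub: "A \<inter> B \<subseteq> U" for U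
  proof -
    define a where "a = orth_proj U x - z"
    have aU: "a \<in> U" unfolding a_def using zC sub orth_proj_mem[OF U] U(1)
      by (blast intro: subspace_diff)
    have ya: "y - a = x - orth_proj U x" by (simp add: y_def a_def)
    have orth: "(y - a) \<bullet> v = 0" if "v \<in> U" for v
      unfolding ya by (rule orth_proj_orthogonal[OF U that])
    have "y \<bullet> a = a \<bullet> a" using orth[OF aU] by (simp add: inner_diff_left)
    moreover have "a \<in> orthogonal_comp (A \<inter> B)"
    proof -
      have "a \<bullet> v = 0" if "v \<in> A \<inter> B" for v
        using orth[of v] yC[OF that] that sub by (auto simp: inner_diff_left)
      then show ?thesis by (auto simp: orthogonal_comp_def orthogonal_def inner_commute)
    qed
    ultimately show ?thesis
      using aU by (auto simp: infdist_eq_norm_minus_orth_proj[OF U] ya)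
  qed
  obtain a where a: "a \<in> A \<inter> orthogonal_comp (A \<inter> B)" "y \<bullet> a = a \<bullet> a" "infdist x A = norm (y - a)"
    using proj[OF A] by auto
  obtain b where b: "b \<in> B \<inter> orthogonal_comp (A \<inter> B)" "y \<bullet> b = b \<bullet> b" "infdist x B = norm (y - b)"
    using proj[OF B] by auto
  have d0: "0 \<le> d" unfolding d_def by (simp add: infdist_nonneg le_max_iff_disj)
  have nya: "norm (y - a) \<le> d" "norm (y - b) \<le> d" unfolding d_def a(3)[symmetric] b(3)[symmetric] by auto
  have A2: "(norm a)\<^sup>2 = (norm y)\<^sup>2 - (norm (y - a))\<^sup>2"
    using a(2) unfolding power2_norm_eq_inner by (simp add: algebra_simps inner_commute)
  have B2: "(norm b)\<^sup>2 = (norm y)\<^sup>2 - (norm (y - b))\<^sup>2"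
    using b(2) unfolding power2_norm_eq_inner by (simp add: algebra_simps inner_commute)
  have "(norm (y - a))\<^sup>2 \<le> d\<^sup>2" "(norm (y - b))\<^sup>2 \<le> d\<^sup>2" using nya by (auto intro: power_mono)
  with A2 B2 have s: "2 * (norm y)\<^sup>2 - 2 * d\<^sup>2 \<le> (norm a)\<^sup>2 + (norm b)\<^sup>2" by linarith
  have "\<bar>(y - a) \<bullet> (y - b)\<bar> \<le> norm (y - a) * norm (y - b)" by (rule Cauchy_Schwarz_ineq2)
  also have "\<dots> \<le> d * d" using nya d0 by (intro mult_mono) auto
  finally have 1: "- (d\<^sup>2) \<le> (y - a) \<bullet> (y - b)" by (simp add: power2_eq_square)
  have 2: "(y - a) \<bullet> (y - b) = (norm y)\<^sup>2 - (norm a)\<^sup>2 - (norm b)\<^sup>2 + a \<bullet> b"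
    using a(2) b(2) unfolding power2_norm_eq_inner by (simp add: algebra_simps inner_commute)
  have "a \<bullet> b \<le> c * (norm a * norm b)" 
    using abs_inner_le_cos_subspace_angle[OF A(1) B(1) a(1) b(1)] unfolding c_def by linarith
  also have "\<dots> \<le> c * (((norm a)\<^sup>2 + (norm b)\<^sup>2) / 2)"
    using c(1) sum_squares_bound[of "norm a" "norm b"] by (intro mult_left_mono) auto
  finally have 3: "a \<bullet> b \<le> c * (((norm a)\<^sup>2 + (norm b)\<^sup>2) / 2)" .
  \<comment> \<open>Lower bound for \<open>a \<bullet> b\<close> by Cauchy-Schwarz for the residues \<open>y - a\<close> and \<open>y - b\<close>, against the upper
      bound by the angle.\<close>
  have "(2 - c) * (2 * (norm y)\<^sup>2 - 2 * d\<^sup>2) \<le> (2 - c) * ((norm a)\<^sup>2 + (norm b)\<^sup>2)"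
    using s c by (intro mult_left_mono) auto
  also have "\<dots> = 2 * ((norm a)\<^sup>2 + (norm b)\<^sup>2) - 2 * (c * (((norm a)\<^sup>2 + (norm b)\<^sup>2) / 2))"
    by (simp add: algebra_simps)
  also have "\<dots> \<le> 2 * (norm y)\<^sup>2 + 2 * d\<^sup>2"
  proof -
    define m where "m = c * (((norm a)\<^sup>2 + (norm b)\<^sup>2) / 2)"
    have "- (d\<^sup>2) \<le> (norm y)\<^sup>2 - (norm a)\<^sup>2 - (norm b)\<^sup>2 + a \<bullet> b" using 1 by (simp only: 2)
    moreover have "a \<bullet> b \<le> m" using 3 by (simp only: m_def)
    ultimately show ?thesis unfolding m_def[symmetric] by argo
  qed
  finally have 4: "(1 - c) * (norm y)\<^sup>2 \<le> (3 - c) * d\<^sup>2" by (simp add: algebra_simps)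
  have "(1 - c\<^sup>2) * (norm y)\<^sup>2 = (1 + c) * ((1 - c) * (norm y)\<^sup>2)"
    by (simp add: algebra_simps power2_eq_square)
  also have "\<dots> \<le> (1 + c) * ((3 - c) * d\<^sup>2)" using 4 c by (intro mult_left_mono) auto
  also have "\<dots> = (4 - (1 - c)\<^sup>2) * d\<^sup>2" by (simp add: algebra_simps power2_eq_square)
  also have "\<dots> \<le> 4 * d\<^sup>2" by (intro mult_right_mono) auto
  finally have "(sin (subspace_angle A B) * norm y)\<^sup>2 \<le> (2 * d)\<^sup>2"
    by (simp add: power_mult_distrib sin_squared_eq c_def)
  then have "sin (subspace_angle A B) * norm y \<le> 2 * d"
    by (rule power2_le_imp_le) (use d0 in simp)
  moreover have "norm y = infdist x (A \<inter> B)"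
    by (simp add: y_def z_def infdist_eq_norm_minus_orth_proj[OF C])
  ultimately show ?thesis by (simp add: d_def)
qed

text \<open>
  If unit vectors \<open>a \<in> A\<close> and \<open>b \<in> B\<close> orthogonal to \<open>A \<inter> B\<close> were nearly equal, then \<open>a\<close> would be close
  to both subspaces while its distance to \<open>A \<inter> B\<close> is its norm.
\<close>

lemma sin_subspace_angle_pos:
  fixes A B :: "'a::real_inner set"
  assumes "subspace A" and "subspace B"
    and reg: "\<And>x. infdist x (A \<inter> B) \<le> K * max (infdist x A) (infdist x B)"
  shows "sin (subspace_angle A B) > 0"
proof -
  define L where "L = max K 1"
  have L: "1 \<le> L" "K \<le> L" by (auto simp: L_def)
  \<comment> \<open>With \<open>t = a \<bullet> b\<close>, the right-hand side tends to zero as \<open>t\<close> tends to one, but the left-hand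
      side does not; \<open>bound\<close> below makes this quantitative.\<close>
  have gap: "(a \<bullet> b)\<^sup>2 \<le> L\<^sup>2 * (2 - 2 * (a \<bullet> b))"
    if a: "a \<in> A \<inter> orthogonal_comp (A \<inter> B)" "norm a \<le> 1" and b: "b \<in> B" "norm b \<le> 1" for a b
  proof -
    have ne: "A \<inter> B \<noteq> {}" using assms(1,2) by (auto dest: subspace_0)
    have "norm a \<le> infdist a (A \<inter> B)"
      unfolding infdist_notempty[OF ne]
    proof (rule cINF_greatest[OF ne])
      fix v assume "v \<in> A \<inter> B"
      then have "a \<bullet> (- v) = 0" using a(1) by (auto simp: orthogonal_comp_def orthogonal_def inner_commute)
      then have "(norm (a + - v))\<^sup>2 = (norm a)\<^sup>2 + (norm (- v))\<^sup>2"
        by (intro norm_add_Pythagorean) (simp add: orthogonal_def)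
      then have "(norm a)\<^sup>2 \<le> (norm (a - v))\<^sup>2" by simp
      then show "norm a \<le> dist a v" by (simp add: dist_norm)
    qed
    also have "\<dots> \<le> K * max (infdist a A) (infdist a B)" by (rule reg)
    also have "\<dots> \<le> L * norm (a - b)"
      using a b L infdist_le[OF b(1), of a]
      by (intro mult_mono) (auto simp: dist_norm infdist_nonneg)
    finally have na: "norm a \<le> L * norm (a - b)" .
    have "\<bar>a \<bullet> b\<bar> \<le> norm a * norm b" by (rule Cauchy_Schwarz_ineq2)
    also have "\<dots> \<le> norm a" using b(2) by (simp add: mult_left_le)
    finally have "\<bar>a \<bullet> b\<bar> \<le> L * norm (a - b)" using na by simp
    then have "(a \<bullet> b)\<^sup>2 \<le> L\<^sup>2 * (norm (a - b))\<^sup>2"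
      using power_mono[of "\<bar>a \<bullet> b\<bar>" "L * norm (a - b)" 2] by (simp add: power_mult_distrib)
    also have "(norm (a - b))\<^sup>2 = (norm a)\<^sup>2 + (norm b)\<^sup>2 - 2 * (a \<bullet> b)"
      unfolding power2_norm_eq_inner by (simp add: algebra_simps inner_commute)
    also have "L\<^sup>2 * \<dots> \<le> L\<^sup>2 * (2 - 2 * (a \<bullet> b))"
      using power_le_one[of "norm a" 2] power_le_one[of "norm b" 2] a(2) b(2)
      by (intro mult_left_mono) auto
    finally show ?thesis .
  qed
  have bound: "t \<le> 1 - 1 / (8 * L\<^sup>2)" if "t\<^sup>2 \<le> L\<^sup>2 * (2 - 2 * t)" for t :: real
  proof (cases "t \<ge> 1/2")
    case True
    then have "(1/2)\<^sup>2 \<le> t\<^sup>2" by (intro power_mono) auto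
    with that have "1/4 \<le> L\<^sup>2 * (2 - 2 * t)" by (simp add: power2_eq_square)
    then show ?thesis using L by (simp add: field_simps)
  next
    case False
    have "1 / (8 * L\<^sup>2) \<le> 1 / 8" using L by (simp add: field_simps)
    with False show ?thesis by linarith
  qed
  have "cos (subspace_angle A B) \<le> 1 - 1 / (8 * L\<^sup>2)"
  proof (rule cos_subspace_angle_le[OF assms(1,2)])
    fix a b assume a: "a \<in> A \<inter> orthogonal_comp (A \<inter> B)" "norm a \<le> 1"
      and b: "b \<in> B \<inter> orthogonal_comp (A \<inter> B)" "norm b \<le> 1"
    have "a \<bullet> b \<le> 1 - 1 / (8 * L\<^sup>2)" using a b by (intro bound gap) auto
    moreover have "- b \<in> B" "norm (- b) \<le> 1" using b assms(2) by (auto simp: subspace_neg)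
    then have "a \<bullet> (- b) \<le> 1 - 1 / (8 * L\<^sup>2)" using a by (intro bound gap) auto
    ultimately show "\<bar>a \<bullet> b\<bar> \<le> 1 - 1 / (8 * L\<^sup>2)" by simp
  qed
  also have "\<dots> < 1" using L by simp
  finally have "(cos (subspace_angle A B))\<^sup>2 < 1"
    using cos_subspace_angle_nonneg[OF assms(1,2)] by (simp add: abs_square_less_1)
  then have "(sin (subspace_angle A B))\<^sup>2 > 0" by (simp add: sin_squared_eq)
  then show ?thesis using sin_subspace_angle_nonneg[OF assms(1,2)] by (simp add: less_le)
qed

section \<open>Counting the large steps\<close>

text \<open>
  Angles enter the count only through \<open>\<kappa>\<close>.  The bound concerns pairs of intersections rather than
  pairs of members, because the intersection of the spaces used so far has to be compared with
  one more space.
\<close>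

locale linearly_regular_family =
  fixes V :: "'i \<Rightarrow> 'a::{real_inner, complete_space} set" and M :: "'i set" and \<kappa> :: real
  assumes finite_M: "finite M"
    and subspace_V: "j \<in> M \<Longrightarrow> subspace (V j)"
    and closed_V: "j \<in> M \<Longrightarrow> closed (V j)"
    and kappa_ge_1: "1 \<le> \<kappa>"
    and infdist_Int_le: "I \<subseteq> M \<Longrightarrow> J \<subseteq> M \<Longrightarrow>
      infdist z ((\<Inter>i\<in>I. V i) \<inter> (\<Inter>j\<in>J. V j))
        \<le> \<kappa> * max (infdist z (\<Inter>i\<in>I. V i)) (infdist z (\<Inter>j\<in>J. V j))"
begin

abbreviation Inters :: "'i set \<Rightarrow> 'a set" where
  "Inters I \<equiv> \<Inter>i\<in>I. V i"

lemma subspace_Inters: "I \<subseteq> M \<Longrightarrow> subspace (Inters I)"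
  by (rule subspace_Int) (use subspace_V in blast)

lemma closed_Inters: "I \<subseteq> M \<Longrightarrow> closed (Inters I)"
  by (rule closed_INT) (use closed_V in blast)

lemma infdist_step_le:
  assumes "J \<subseteq> M" and "i \<in> J" and "lam \<in> {0..2}"
  shows "infdist (relaxed_proj (V i) lam z) (Inters J) \<le> infdist z (Inters J)"
proof (rule infdist_relaxed_proj_le)
  have "i \<in> M" using assms(1,2) by blast
  then show "subspace (V i)" "closed (V i)" by (rule subspace_V, rule closed_V)
  show "subspace (Inters J)" "closed (Inters J)"
    using assms(1) by (rule subspace_Inters, rule closed_Inters)
  show "Inters J \<subseteq> V i" using assms(2) by blast
  show "lam \<in> {0..2}" by (fact assms(3))
qed

text \<open>
  A new index costs one factor \<open>\<kappa>\<close>, because the point is then close both to the old intersection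
  and to the new space; a repeated index costs nothing, because a step onto a space never
  increases the distance to a subspace of it.
\<close>

lemma infdist_used_spaces_le:
  assumes "i ` {..<n} \<subseteq> M"
    and "\<And>m. m < n \<Longrightarrow> x (Suc m) = relaxed_proj (V (i m)) (lam m) (x m)"
    and "\<And>m. m < n \<Longrightarrow> lam m \<in> {0..2}"
    and "0 \<le> r"
    and "\<And>m. m < n \<Longrightarrow> infdist (x m) (V (i m)) \<le> r"
  shows "infdist (x n) (Inters (i ` {..<n})) \<le> \<kappa> ^ card (i ` {..<n}) * r"
  using assms
proof (induction n)
  case 0
  then show ?case by (simp add: infdist_zero)
next
  case (Suc n)
  let ?I = "i ` {..<n}"
  have I': "i ` {..<Suc n} = insert (i n) ?I" by (simp add: lessThan_Suc)
  have sub: "insert (i n) ?I \<subseteq> M" using Suc.prems(1) unfolding I' .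
  have IH: "infdist (x n) (Inters ?I) \<le> \<kappa> ^ card ?I * r"
    using sub Suc.prems by (intro Suc.IH) auto
  have "infdist (x (Suc n)) (Inters (insert (i n) ?I)) \<le> infdist (x n) (Inters (insert (i n) ?I))"
    using infdist_step_le[OF sub, of "i n" "lam n" "x n"] Suc.prems(2,3) by simp
  also have "\<dots> \<le> \<kappa> ^ card (insert (i n) ?I) * r"
  proof (cases "i n \<in> ?I")
    case True
    then show ?thesis using IH by (simp only: insert_absorb)
  next
    case False
    have 1: "1 \<le> \<kappa> ^ card ?I" using kappa_ge_1 by (rule one_le_power)
    have "infdist (x n) (Inters {i n}) \<le> 1 * r" using Suc.prems(5) by simp
    also have "\<dots> \<le> \<kappa> ^ card ?I * r" using 1 Suc.prems(4) by (rule mult_right_mono)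
    finally have "max (infdist (x n) (Inters {i n})) (infdist (x n) (Inters ?I)) \<le> \<kappa> ^ card ?I * r"
      using IH by (rule max.boundedI)
    then have "\<kappa> * max (infdist (x n) (Inters {i n})) (infdist (x n) (Inters ?I))
        \<le> \<kappa> * (\<kappa> ^ card ?I * r)"
      using kappa_ge_1 by (intro mult_left_mono) auto
    moreover have "Inters (insert (i n) ?I) = Inters {i n} \<inter> Inters ?I" by auto
    ultimately have "infdist (x n) (Inters (insert (i n) ?I)) \<le> \<kappa> * (\<kappa> ^ card ?I * r)"
      using infdist_Int_le[of "{i n}" ?I "x n"] sub by simp
    then show ?thesis using False by simp
  qed
  finally show ?case unfolding I' .
qed

text \<open>
  Induction along Pascal's rule, as explained at the beginning.  It needs finite stretches of
  steps, since the steps before the cut form one; hence the length \<open>L\<close>.  The constants \<open>\<epsilon>\<close> and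
  \<open>\<beta>\<close> belong to the whole family \<open>M\<close> and are kept for all the subfamilies \<open>J\<close>.
\<close>

lemma card_large_steps_less_binomial:
  fixes x :: "nat \<Rightarrow> 'a"
  assumes eta: "\<eta> \<in> {0<..1}"
    and eps: "0 \<le> \<epsilon>" "\<kappa> ^ card M * \<epsilon> \<le> 1/2"
    and beta: "1/2 \<le> \<beta>" "\<beta>\<^sup>2 = 1 - \<eta> * (2 - \<eta>) * \<epsilon>\<^sup>2"
    and "J \<subseteq> M" and "i ` {..<L} \<subseteq> J"
    and "\<And>n. n < L \<Longrightarrow> lam n \<in> {\<eta>..2 - \<eta>}"
    and "\<And>n. n < L \<Longrightarrow> x (Suc n) = relaxed_proj (V (i n)) (lam n) (x n)"
    and "\<beta> ^ k * infdist (x 0) (Inters J) < t"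
  shows "card {n. n < L \<and> t \<le> infdist (x n) (V (i n))} < (card J + k) choose k"
  using assms(6-)
proof (induction "card J + k" arbitrary: J k L i lam x rule: less_induct)
  case less
  note J = less.prems(1) and iJ = less.prems(2) and lam = less.prems(3)
    and step = less.prems(4) and start = less.prems(5)
  define D where "D n = infdist (x n) (Inters J)" for n
  define B where "B L' = {n. n < L' \<and> t \<le> infdist (x n) (V (i n))}" for L'
  have finB: "finite (B L')" for L' unfolding B_def by simp
  have finJ: "finite J" using J finite_M by (rule finite_subset)
  have D0: "0 \<le> D n" for n unfolding D_def by (rule infdist_nonneg)
  have iM: "i n \<in> M" if "n < L" for n using iJ J that by auto
  have lam2: "lam n \<in> {0..2}" if "n < L" for n using lam[OF that] eta by auto
  have Dstep: "D (Suc n) \<le> D n" if "n < L" for n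
    unfolding D_def step[OF that] using that iJ by (intro infdist_step_le[OF J] lam2) auto
  have Dle: "D n \<le> D 0" if "n \<le> L" for n
    using that
  proof (induction n)
    case (Suc n)
    then show ?case using Dstep[of n] by simp
  qed simp
  have dD: "infdist (x n) (V (i n)) \<le> D n" if "n < L" for n
    unfolding D_def using that iJ subspace_0[OF subspace_Inters[OF J]]
    by (intro infdist_mono) auto
  consider "L = 0" | "L > 0" "k = 0" | k' where "L > 0" "k = Suc k'"
    by (metis not0_implies_Suc neq0_conv)
  then show ?case
  proof cases
    case 1
    then show ?thesis by simp
  next
    case 2
    have "infdist (x n) (V (i n)) < t" if "n < L" for n
      using dD[OF that] Dle[of n] start 2 that by (simp add: D_def)
    then have "B L = {}" by (auto simp: B_def not_le)
    then have "card (B L) < (card J + k) choose k" by simp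
    then show ?thesis unfolding B_def .
  next
    case k: 3
    have Jne: "card J > 0" using iJ k(1) finJ by (auto simp: card_gt_0_iff)
    \<comment> \<open>The cut, or \<open>L\<close> if \<open>D\<close> never drops by the factor \<open>\<beta>\<close>.\<close>
    define n\<^sub>0 where "n\<^sub>0 = (LEAST n. L \<le> n \<or> D (Suc n) \<le> \<beta> * D 0)"
    have n0: "L \<le> n\<^sub>0 \<or> D (Suc n\<^sub>0) \<le> \<beta> * D 0" and n0L: "n\<^sub>0 \<le> L"
      unfolding n\<^sub>0_def by (rule LeastI[of _ L], simp) (rule Least_le, simp)
    have before: "\<beta> * D 0 < D (Suc n)" if "n < n\<^sub>0" for n
      using not_less_Least[OF that[unfolded n\<^sub>0_def]] by auto
    let ?I = "i ` {..<n\<^sub>0}"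
    have IJ: "?I \<subseteq> J" using iJ n0L by auto
    have near: "infdist (x n) (V (i n)) \<le> \<epsilon> * D 0" if "n < n\<^sub>0" for n
    proof -
      have nL: "n < L" using that n0L by simp
      have le: "\<eta> * (2 - \<eta>) \<le> lam n * (2 - lam n)"
      proof -
        have "0 \<le> (lam n - \<eta>) * (2 - \<eta> - lam n)" using lam[OF nL] by simp
        then show ?thesis by (simp add: algebra_simps)
      qed
      have pos: "0 < \<eta> * (2 - \<eta>)" using eta by auto
      have "(\<beta> * D 0)\<^sup>2 \<le> (D (Suc n))\<^sup>2"
        using before[OF that] beta(1) D0 by (intro power_mono) auto
      also have "\<dots> \<le> (D n)\<^sup>2 - lam n * (2 - lam n) * (infdist (x n) (V (i n)))\<^sup>2"
        unfolding D_def step[OF nL]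
        by (rule infdist_relaxed_proj_power2_le)
          (use J iJ nL iM[OF nL] in \<open>auto intro: subspace_V closed_V subspace_Inters closed_Inters\<close>)
      also have "\<dots> \<le> (D 0)\<^sup>2 - \<eta> * (2 - \<eta>) * (infdist (x n) (V (i n)))\<^sup>2"
        using nL le Dle[of n] D0[of n] by (intro diff_mono power_mono mult_right_mono) auto
      finally have "\<eta> * (2 - \<eta>) * (infdist (x n) (V (i n)))\<^sup>2 \<le> \<eta> * (2 - \<eta>) * (\<epsilon> * D 0)\<^sup>2"
        using beta(2) by (simp add: power_mult_distrib algebra_simps)
      then have "(infdist (x n) (V (i n)))\<^sup>2 \<le> (\<epsilon> * D 0)\<^sup>2"
        using pos by (rule mult_left_le_imp_le)
      then show ?thesis by (rule power2_le_imp_le) (use eps(1) D0 in simp)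
    qed
    \<comment> \<open>If all of \<open>J\<close> were used, \<open>D\<close> would have dropped to half its initial value already.\<close>
    have "?I \<noteq> J"
    proof
      assume eq: "?I = J"
      have "n\<^sub>0 \<noteq> 0" using eq Jne by (intro notI) simp
      then obtain m where m: "n\<^sub>0 = Suc m" using not0_implies_Suc by blast
      have "D n\<^sub>0 \<le> \<kappa> ^ card J * (\<epsilon> * D 0)"
        using infdist_used_spaces_le[of i n\<^sub>0 x lam "\<epsilon> * D 0"] near eps(1) D0[of 0] step lam2 n0L J
        unfolding D_def eq by auto
      also have "\<dots> \<le> \<kappa> ^ card M * (\<epsilon> * D 0)"
        using kappa_ge_1 J finite_M eps(1) D0[of 0]
        by (intro mult_right_mono power_increasing card_mono) auto
      also have "\<dots> \<le> 1/2 * D 0" using mult_right_mono[OF eps(2) D0[of 0]] by (simp add: mult.assoc)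
      also have "\<dots> \<le> \<beta> * D 0" using beta(1) D0 by (rule mult_right_mono)
      finally show False using before[of m] m by simp
    qed
    then have "?I \<subset> J" using IJ by blast
    then have cI: "card ?I < card J" using finJ by (rule psubset_card_mono[rotated])
    have "infdist (x 0) (Inters ?I) \<le> D 0"
      unfolding D_def using IJ subspace_0[OF subspace_Inters[OF J]] by (intro infdist_mono) auto
    then have "\<beta> ^ k * infdist (x 0) (Inters ?I) \<le> \<beta> ^ k * D 0"
      using beta(1) by (intro mult_left_mono) auto
    then have "card (B n\<^sub>0) < (card ?I + k) choose k"
      unfolding B_def using cI IJ J n0L lam step start
      by (intro less.hyps) (auto simp: D_def)
    also have "\<dots> \<le> ((card J - 1) + k) choose k" using cI by (intro binomial_right_mono) auto
    finally have first: "card (B n\<^sub>0) < ((card J - 1) + k) choose k" .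
    have pascal: "(card J + k) choose k = (((card J - 1) + k) choose k) + ((card J + k') choose k')"
      using Jne k(2) by (cases "card J") auto
    show ?thesis
    proof (cases "n\<^sub>0 = L")
      case True
      then show ?thesis using first pascal unfolding B_def by simp
    next
      case False
      then have nL: "n\<^sub>0 < L" and drop: "D (Suc n\<^sub>0) \<le> \<beta> * D 0" using n0 n0L by auto
      define C where "C = {n. n < L - Suc n\<^sub>0 \<and> t \<le> infdist (x (Suc n\<^sub>0 + n)) (V (i (Suc n\<^sub>0 + n)))}"
      have "\<beta> ^ k' * D (Suc n\<^sub>0) \<le> \<beta> ^ k' * (\<beta> * D 0)"
        using drop beta(1) by (intro mult_left_mono) auto
      then have "\<beta> ^ k' * D (Suc n\<^sub>0) < t" using start k(2) by (simp add: D_def mult_ac)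
      then have second: "card C < (card J + k') choose k'"
        unfolding C_def using k(2) J iJ lam step
        by (intro less.hyps[where lam = "\<lambda>n. lam (Suc n\<^sub>0 + n)"]) (auto simp: D_def)
      have "B L \<subseteq> B n\<^sub>0 \<union> {n\<^sub>0} \<union> (\<lambda>n. Suc n\<^sub>0 + n) ` C"
      proof
        fix n assume n: "n \<in> B L"
        consider "n < n\<^sub>0" | "n = n\<^sub>0" | "n = Suc n\<^sub>0 + (n - Suc n\<^sub>0)" "n > n\<^sub>0" by linarith
        then show "n \<in> B n\<^sub>0 \<union> {n\<^sub>0} \<union> (\<lambda>n. Suc n\<^sub>0 + n) ` C"
        proof cases
          case 3
          then have "n - Suc n\<^sub>0 \<in> C" using n by (auto simp: B_def C_def)
          then show ?thesis using 3 by blast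
        qed (use n in \<open>auto simp: B_def\<close>)
      qed
      moreover have "finite C" unfolding C_def by simp
      ultimately have "card (B L) \<le> card (B n\<^sub>0 \<union> {n\<^sub>0} \<union> (\<lambda>n. Suc n\<^sub>0 + n) ` C)"
        using finB by (intro card_mono) auto
      also have "\<dots> \<le> card (B n\<^sub>0) + 1 + card C"
        using card_Un_le[of "B n\<^sub>0 \<union> {n\<^sub>0}" "(\<lambda>n. Suc n\<^sub>0 + n) ` C"] card_Un_le[of "B n\<^sub>0" "{n\<^sub>0}"]
          card_image_le[OF \<open>finite C\<close>, of "\<lambda>n. Suc n\<^sub>0 + n"] by simp
      also have "\<dots> < (card J + k) choose k" using first second pascal by simp
      finally show ?thesis unfolding B_def .
    qed
  qed
qed

end

section \<open>Decreasing rearrangements\<close>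

text \<open>
  For each \<open>n\<close> in turn, choose an index of maximal value among those not chosen before.  The
  maximum exists because only finitely many values exceed a given positive one.  No index with
  positive value is missed, since otherwise infinitely many values would be at least as large.
\<close>

lemma is_decreasing_rearrangement_decreasing_rearrangement:
  fixes d :: "nat \<Rightarrow> real"
  assumes nonneg: "\<And>k. 0 \<le> d k" and fin: "\<And>t. 0 < t \<Longrightarrow> finite {k. t \<le> d k}"
  shows "is_decreasing_rearrangement d (decreasing_rearrangement d)"
proof -
  have max: "\<exists>k. k \<notin> F \<and> (\<forall>j. j \<notin> F \<longrightarrow> d j \<le> d k)" if F: "finite F" for F
  proof (cases "\<exists>j. j \<notin> F \<and> d j > 0")
    case True
    then obtain j where j: "j \<notin> F" "d j > 0" by blast
    define G where "G = {k. d j \<le> d k} - F"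
    have G: "finite G" "j \<in> G" unfolding G_def using fin[OF j(2)] j(1) by auto
    then have "Max (d ` G) \<in> d ` G" by (intro Max_in) auto
    then obtain k where k: "k \<in> G" "d k = Max (d ` G)" by (metis imageE)
    have "d l \<le> d k" if "l \<notin> F" for l
    proof (cases "d j \<le> d l")
      case True
      then show ?thesis using that G(1) unfolding k(2) by (intro Max_ge) (auto simp: G_def)
    next
      case False
      then show ?thesis using k(1) by (auto simp: G_def)
    qed
    then show ?thesis using k(1) by (auto simp: G_def)
  next
    case False
    obtain k where "k \<notin> F" using F by (metis ex_new_if_finite infinite_UNIV_nat)
    then show ?thesis using False nonneg[of k] by (intro exI[of _ k]) (force simp: not_less)
  qed
  let ?P = "\<lambda>(\<pi> :: nat \<Rightarrow> nat) (n :: nat) k. k \<notin> \<pi> ` {..<n} \<and> (\<forall>j. j \<notin> \<pi> ` {..<n} \<longrightarrow> d j \<le> d k)"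
  have "\<exists>\<pi>. \<forall>n. ?P \<pi> n (\<pi> n)"
  proof (rule dependent_wf_choice[OF wf_less, where P = "?P"])
    fix f g :: "nat \<Rightarrow> nat" and n k
    assume "\<And>m. (m, n) \<in> {(x, y). x < y} \<Longrightarrow> f m = g m"
    then have "f ` {..<n} = g ` {..<n}" by (intro image_cong) auto
    then show "?P f n k = ?P g n k" by simp
  next
    fix n :: nat and f :: "nat \<Rightarrow> nat"
    show "\<exists>k. ?P f n k" by (rule max) simp
  qed
  then obtain \<pi> where \<pi>: "\<forall>n. ?P \<pi> n (\<pi> n)" ..
  have new: "\<pi> n \<notin> \<pi> ` {..<n}" for n
    using \<pi>[rule_format, of n] by blast
  have large: "d j \<le> d (\<pi> n)" if "j \<notin> \<pi> ` {..<n}" for n j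
    using \<pi>[rule_format, of n] that by blast
  have inj: "inj \<pi>"
  proof (rule linorder_injI)
    fix m n :: nat assume "m < n"
    then show "\<pi> m \<noteq> \<pi> n" using new[of n] by (metis image_eqI lessThan_iff)
  qed
  have "decseq (\<lambda>n. d (\<pi> n))"
  proof (rule decseq_SucI)
    fix n
    show "d (\<pi> (Suc n)) \<le> d (\<pi> n)" using new[of "Suc n"] by (intro large) auto
  qed
  moreover have "{k. d k \<noteq> 0} \<subseteq> range \<pi>"
  proof (rule subsetI, rule ccontr)
    fix k assume k: "k \<in> {k. d k \<noteq> 0}" "k \<notin> range \<pi>"
    then have "range \<pi> \<subseteq> {j. d k \<le> d j}" by (auto intro: large)
    moreover have "0 < d k" using k(1) nonneg[of k] by (simp add: less_le)
    ultimately have "finite (range \<pi>)" using fin finite_subset by blast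
    then show False using inj finite_imageD infinite_UNIV_nat by blast
  qed
  ultimately have *: "is_decreasing_rearrangement d (\<lambda>n. d (\<pi> n))"
    unfolding is_decreasing_rearrangement_def using inj by blast
  show ?thesis using * unfolding decreasing_rearrangement_eqI[OF nonneg *] .
qed

lemma decreasing_rearrangement_less_card:
  fixes d :: "nat \<Rightarrow> real"
  assumes nonneg: "\<And>k. 0 \<le> d k" and fin: "\<And>t. 0 < t \<Longrightarrow> finite {k. t \<le> d k}"
    and pos: "0 < decreasing_rearrangement d n"
  shows "n < card {k. decreasing_rearrangement d n \<le> d k}"
proof -
  define s where "s = decreasing_rearrangement d"
  have "is_decreasing_rearrangement d s"
    unfolding s_def using nonneg fin by (rule is_decreasing_rearrangement_decreasing_rearrangement)
  then obtain \<pi> where s: "decseq s" "inj \<pi>" "\<And>m. s m = d (\<pi> m)"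
    unfolding is_decreasing_rearrangement_def by blast
  have "\<pi> ` {..n} \<subseteq> {k. s n \<le> d k}" using decseqD[OF s(1)] by (auto simp flip: s(3))
  then have "card (\<pi> ` {..n}) \<le> card {k. s n \<le> d k}"
    using fin pos by (intro card_mono) (auto simp: s_def)
  moreover have "card (\<pi> ` {..n}) = Suc n" using s(2) by (simp add: card_image inj_on_subset)
  ultimately show ?thesis by (simp add: s_def)
qed

section \<open>The constants\<close>

text \<open>
  The intersection of \<open>V\<^sub>I\<close> and \<open>V\<^sub>J\<close> is \<open>V\<^bsub>I \<union> J\<^esub>\<close>, and each \<open>V\<^sub>l\<close> with \<open>l \<in> I \<union> J\<close> is at most as far away
  as \<open>V\<^sub>I\<close> or \<open>V\<^sub>J\<close>, so regularity of the subcollection \<open>I \<union> J\<close> carries over to this pair.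
\<close>

lemma regular_intersections:
  fixes V :: "nat \<Rightarrow> 'a::{real_inner, complete_space} set"
  assumes sub: "\<And>j. j \<in> {1..N} \<Longrightarrow> subspace (V j)"
    and reg: "innately_regular N V"
    and I: "I \<subseteq> {1..N}" and J: "J \<subseteq> {1..N}"
  obtains K where "\<And>x. infdist x ((\<Inter>i\<in>I. V i) \<inter> (\<Inter>j\<in>J. V j))
      \<le> K * max (infdist x (\<Inter>i\<in>I. V i)) (infdist x (\<Inter>j\<in>J. V j))"
proof (cases "I \<union> J = {}")
  case True
  show thesis by (rule that[of 0]) (use True in simp)
next
  case False
  have "regular_on (I \<union> J) V" 
    using reg I J False by (simp add: innately_regular_def)
  then obtain K where K: "\<And>x. infdist x (\<Inter>i\<in>I \<union> J. V i) \<le> K * (MAX i\<in>I \<union> J. infdist x (V i))"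
    unfolding regular_on_def by blast
  have fin: "finite (I \<union> J)" using I J by (meson finite_Un finite_atLeastAtMost finite_subset)
  \<comment> \<open>If all the distances vanish, the constant that regularity provides may be negative.\<close>
  show thesis
  proof (rule that[of "max K 0"])
    fix x
    let ?m = "max (infdist x (\<Inter>i\<in>I. V i)) (infdist x (\<Inter>j\<in>J. V j))"
    let ?M = "MAX i\<in>I \<union> J. infdist x (V i)"
    have ne: "(\<Inter>i\<in>I. V i) \<noteq> {}" if "I \<subseteq> {1..N}" for I
      using that subspace_0[OF sub] by blast
    have "?M \<in> (\<lambda>i. infdist x (V i)) ` (I \<union> J)" using fin False by (intro Max_in) auto
    then obtain l where l: "l \<in> I \<union> J" "?M = infdist x (V l)" by blast
    have "?M \<le> ?m"
    proof (cases "l \<in> I")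
      case True
      then have "infdist x (V l) \<le> infdist x (\<Inter>i\<in>I. V i)"
        using ne[OF I] by (intro infdist_mono) auto
      then show ?thesis unfolding l(2) by simp
    next
      case False
      then have "infdist x (V l) \<le> infdist x (\<Inter>i\<in>J. V i)"
        using l(1) ne[OF J] by (intro infdist_mono) auto
      then show ?thesis unfolding l(2) by simp
    qed
    have "0 \<le> ?M" unfolding l(2) by (rule infdist_nonneg)
    have "infdist x ((\<Inter>i\<in>I. V i) \<inter> (\<Inter>j\<in>J. V j)) = infdist x (\<Inter>i\<in>I \<union> J. V i)"
      by (simp only: INT_Un)
    also have "\<dots> \<le> K * ?M" by (rule K)
    also have "\<dots> \<le> max K 0 * ?M" using \<open>0 \<le> ?M\<close> by (intro mult_right_mono) auto
    also have "\<dots> \<le> max K 0 * ?m" using \<open>?M \<le> ?m\<close> by (intro mult_left_mono) auto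
    finally show "infdist x ((\<Inter>i\<in>I. V i) \<inter> (\<Inter>j\<in>J. V j)) \<le> max K 0 * ?m" .
  qed
qed

lemma
  fixes V :: "nat \<Rightarrow> 'a::{real_inner, complete_space} set"
  assumes sub: "\<And>j. j \<in> {1..N} \<Longrightarrow> subspace (V j)"
    and cl: "\<And>j. j \<in> {1..N} \<Longrightarrow> closed (V j)"
    and reg: "innately_regular N V"
  shows kappa_star_ge_2: "2 \<le> kappa_star N V"
    and linearly_regular_family_kappa_star:
      "linearly_regular_family V {1..N} (kappa_star N V)"
proof -
  define S where "S = {2 / sin (subspace_angle (\<Inter>i\<in>I. V i) (\<Inter>j\<in>J. V j)) | I J.
       I \<subseteq> {1..N} \<and> J \<subseteq> {1..N}}"
  have "S = (\<lambda>(I, J). 2 / sin (subspace_angle (\<Inter>i\<in>I. V i) (\<Inter>j\<in>J. V j)))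
      ` (Pow {1..N} \<times> Pow {1..N})"
    unfolding S_def by auto
  then have fin: "finite S" by (metis finite_imageI finite_cartesian_product finite_Pow_iff finite_atLeastAtMost)
  have sub': "subspace (\<Inter>i\<in>I. V i)" if "I \<subseteq> {1..N}" for I
    by (rule subspace_Int) (use sub that in blast)
  have cl': "closed (\<Inter>i\<in>I. V i)" if "I \<subseteq> {1..N}" for I
    by (rule closed_INT) (use cl that in blast)
  have pos: "0 < sin (subspace_angle (\<Inter>i\<in>I. V i) (\<Inter>j\<in>J. V j))"
    if IJ: "I \<subseteq> {1..N}" "J \<subseteq> {1..N}" for I J
  proof -
    obtain K where "\<And>x. infdist x ((\<Inter>i\<in>I. V i) \<inter> (\<Inter>j\<in>J. V j))
      \<le> K * max (infdist x (\<Inter>i\<in>I. V i)) (infdist x (\<Inter>j\<in>J. V j))"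
      using regular_intersections[OF sub reg IJ] by metis
    then show ?thesis by (rule sin_subspace_angle_pos[OF sub' sub', OF IJ])
  qed
  have le: "2 / sin (subspace_angle (\<Inter>i\<in>I. V i) (\<Inter>j\<in>J. V j)) \<le> kappa_star N V"
    if "I \<subseteq> {1..N}" "J \<subseteq> {1..N}" for I J
    unfolding kappa_star_def S_def[symmetric] by (rule Max_ge[OF fin]) (use that in \<open>auto simp: S_def\<close>)
  have "2 \<le> 2 / sin (subspace_angle (\<Inter>i\<in>{}. V i) (\<Inter>j\<in>{}. V j))"
    using pos[of "{}" "{}"] by (simp add: le_divide_eq)
  also have "\<dots> \<le> kappa_star N V" by (rule le) auto
  finally show two: "2 \<le> kappa_star N V" .
  show "linearly_regular_family V {1..N} (kappa_star N V)"
  proof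
    fix I J z assume IJ: "I \<subseteq> {1..N}" "J \<subseteq> {1..N}"
    let ?A = "\<Inter>i\<in>I. V i" and ?B = "\<Inter>j\<in>J. V j"
    let ?m = "max (infdist z ?A) (infdist z ?B)"
    have "sin (subspace_angle ?A ?B) * infdist z (?A \<inter> ?B) \<le> 2 * ?m"
      using IJ by (intro sin_subspace_angle_times_infdist_le sub' cl')
    then have "infdist z (?A \<inter> ?B) \<le> 2 / sin (subspace_angle ?A ?B) * ?m"
      using pos[OF IJ] by (simp add: field_simps)
    also have "\<dots> \<le> kappa_star N V * ?m"
      using le[OF IJ] by (intro mult_right_mono) (auto simp: infdist_nonneg le_max_iff_disj)
    finally show "infdist z (?A \<inter> ?B) \<le> kappa_star N V * ?m" .
  qed (use sub cl two in auto)
qed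

lemma
  assumes kap: "2 \<le> kappa_star N V"
  shows eps_star_pos: "0 < eps_star N V"
    and kappa_star_power_eps_star: "kappa_star N V ^ N * eps_star N V = 1/2"
    and eps_star_le_half: "eps_star N V \<le> 1/2"
proof -
  let ?k = "kappa_star N V" and ?e = "eps_star N V"
  have e: "?e = 1/2 / ?k ^ N" by (simp add: eps_star_def power_int_minus field_simps)
  show "0 < ?e" unfolding e using kap by simp
  show "?k ^ N * ?e = 1/2" unfolding e using kap by simp
  have "1 \<le> ?k ^ N" using kap by (intro one_le_power) simp
  then show "?e \<le> 1/2" unfolding e by (simp add: field_simps)
qed

lemma
  assumes kap: "2 \<le> kappa_star N V" and eta: "\<eta> \<in> {0<..1}"
  shows beta_star_power2: "(beta_star N V \<eta>)\<^sup>2 = 1 - \<eta> * (2 - \<eta>) * (eps_star N V)\<^sup>2"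
    and beta_star_ge: "1/2 \<le> beta_star N V \<eta>"
    and beta_star_less_1: "beta_star N V \<eta> < 1"
proof -
  let ?e = "eps_star N V"
  have pos: "0 < ?e" by (rule eps_star_pos[OF kap])
  have e2: "?e\<^sup>2 \<le> (1/2)\<^sup>2" using eps_star_le_half[OF kap] pos by (intro power_mono) auto
  have "0 \<le> (1 - \<eta>)\<^sup>2" by simp
  then have eta1: "\<eta> * (2 - \<eta>) \<le> 1" by (simp add: power2_eq_square algebra_simps)
  have eta0: "0 < \<eta> * (2 - \<eta>)" using eta by auto
  have "\<eta> * (2 - \<eta>) * ?e\<^sup>2 \<le> 1 * (1/2)\<^sup>2" using eta1 e2 by (intro mult_mono) auto
  then have quarter: "(1/2)\<^sup>2 \<le> 1 - \<eta> * (2 - \<eta>) * ?e\<^sup>2" by (simp add: power2_eq_square)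
  have lt: "1 - \<eta> * (2 - \<eta>) * ?e\<^sup>2 < 1" using eta0 pos by simp
  have "0 \<le> 1 - \<eta> * (2 - \<eta>) * ?e\<^sup>2" using quarter by (rule order_trans[rotated]) simp
  then show "(beta_star N V \<eta>)\<^sup>2 = 1 - \<eta> * (2 - \<eta>) * ?e\<^sup>2" by (simp add: beta_star_def)
  show "1/2 \<le> beta_star N V \<eta>" unfolding beta_star_def using quarter by (rule real_le_rsqrt)
  show "beta_star N V \<eta> < 1" unfolding beta_star_def using lt by simp
qed

section \<open>From binomial coefficients to the stretched exponential\<close>

text \<open>
  From \<open>(N + k) choose N \<le> (N + k)\<^sup>N / N!\<close> and \<open>N\<^sup>N / N! \<le> e\<^sup>N\<close>, the latter being one term of the
  exponential series.
\<close>

lemma binomial_le_3_power: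
  assumes "1 \<le> N"
  shows "real ((N + k) choose k) \<le> (3 * real (N + k) / real N) ^ N"
proof -
  have N: "0 < real N" using assms by simp
  have "real N ^ N / fact N \<le> exp (real N)"
  proof -
    have "(\<Sum>n\<in>{N}. inverse (fact n) *\<^sub>R real N ^ n) \<le> (\<Sum>n. inverse (fact n) *\<^sub>R real N ^ n)"
      by (rule sum_le_suminf[OF summable_exp_generic]) auto
    then show ?thesis by (simp add: exp_def divide_inverse mult.commute)
  qed
  also have "\<dots> = exp 1 ^ N" by (simp add: exp_of_nat_mult[symmetric])
  also have "\<dots> \<le> 3 ^ N" using exp_bound[of 1] by (intro power_mono) auto
  finally have fact: "real N ^ N \<le> 3 ^ N * fact N" by (simp add: field_simps)
  have "(N + k) choose k = (N + k) choose N" by (subst binomial_symmetric) auto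
  then have "real ((N + k) choose k) * fact N \<le> real (N + k) ^ N"
    using binomial_fact_pow[of "N + k" N]
    by (metis of_nat_fact of_nat_le_iff of_nat_mult of_nat_power)
  then have "real ((N + k) choose k) * real N ^ N \<le> 3 ^ N * real (N + k) ^ N"
  proof -
    have "real ((N + k) choose k) * real N ^ N \<le> real ((N + k) choose k) * (3 ^ N * fact N)"
      using fact by (rule mult_left_mono) simp
    also have "\<dots> = 3 ^ N * (real ((N + k) choose k) * fact N)" by (simp only: mult_ac)
    also have "\<dots> \<le> 3 ^ N * real (N + k) ^ N"
      using \<open>real ((N + k) choose k) * fact N \<le> real (N + k) ^ N\<close> by (rule mult_left_mono) simp
    finally show ?thesis .
  qed
  then show ?thesis
    unfolding power_divide power_mult_distrib using N by (simp only: pos_le_divide_eq zero_less_power)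
qed

text \<open>
  By the preceding bound the hypothesis gives \<open>N n\<^bsup>1/N\<^esup> < 3 (N + k + 1)\<close>,
  so that \<open>k > N n\<^bsup>1/N\<^esup> / 9 - N\<close> with room to spare: the
  constant \<open>9\<close> instead of \<open>3\<close> absorbs the shift from \<open>k\<close> to \<open>Suc k\<close>, that is, the rounding of the
  logarithm of the threshold to an integer.
\<close>

lemma power_less_stretched_exp:
  fixes \<beta> :: real
  assumes N: "1 \<le> N" and beta: "0 < \<beta>" "\<beta> < 1" and n: "n < (N + Suc k) choose Suc k"
  shows "\<beta> ^ k < \<beta> powi (- int N) * exp (- (real N / 9 * ln (inverse \<beta>)) * real n powr (1 / real N))"
proof -
  define m where "m = real n powr (1 / real N)"
  have N0: "0 < real N" using N by simp
  have "real n < (3 * real (N + Suc k) / real N) ^ N"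
    using binomial_le_3_power[OF N, of "Suc k"] n by (meson less_le_trans of_nat_less_iff)
  also have "\<dots> = (3 * real (N + Suc k) / real N) powr real N"
    using N0 by (simp add: powr_realpow)
  finally have "m < ((3 * real (N + Suc k) / real N) powr real N) powr (1 / real N)"
    unfolding m_def using N0 by (intro powr_less_mono2) auto
  then have "m < 3 * real (N + Suc k) / real N" using N0 by (simp add: powr_powr)
  then have "real N * m < 3 * real (N + Suc k)" using N0 by (simp add: field_simps)
  then have lt: "real N / 9 * m - real N < real k" using N by simp
  have "\<beta> ^ k = exp (real k * ln \<beta>)" using beta by (simp add: exp_of_nat_mult)
  also have "\<dots> < exp ((real N / 9 * m - real N) * ln \<beta>)"
    using mult_strict_right_mono_neg[OF lt, of "ln \<beta>"] beta by simp
  also have "\<dots> = exp (- (real N * ln \<beta>)) * exp (real N / 9 * m * ln \<beta>)"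
    by (simp add: algebra_simps flip: exp_add)
  also have "exp (- (real N * ln \<beta>)) = \<beta> powi (- int N)"
    using beta by (simp add: exp_minus exp_of_nat_mult power_int_minus)
  also have "real N / 9 * m * ln \<beta> = - (real N / 9 * ln (inverse \<beta>)) * m"
    using beta by (simp add: ln_inverse)
  finally show ?thesis unfolding m_def .
qed

theorem theorem5p3:
  fixes N :: nat
    and V :: "nat \<Rightarrow> 'a::{real_inner, complete_space} set"
    and \<eta> :: real
    and x\<^sub>0 :: 'a
    and i :: "nat \<Rightarrow> nat"
    and lam :: "nat \<Rightarrow> real"
    and x :: "nat \<Rightarrow> 'a"
    and \<delta> :: "nat \<Rightarrow> real"
  assumes "N \<ge> 1"
    and "\<And>j. j \<in> {1..N} \<Longrightarrow> subspace (V j)"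
    and "\<And>j. j \<in> {1..N} \<Longrightarrow> closed (V j)"
    and "innately_regular N V"
    and "\<eta> \<in> {0<..1}"
    and "x\<^sub>0 \<noteq> 0"
    and "\<And>n. i n \<in> {1..N}"
    and "\<And>n. lam n \<in> {\<eta>..2 - \<eta>}"
    and "x 0 = x\<^sub>0"
    and "\<And>n. x (Suc n) = relaxed_proj (V (i n)) (lam n) (x n)"
    and "\<And>n. \<delta> n = norm (x (Suc n) - x n) / ((2 - \<eta>) * norm x\<^sub>0)"
  shows "rho_star N V \<eta> > 0 \<and>
    (\<forall>n. decreasing_rearrangement \<delta> n
           < c_star N V \<eta> * exp (- rho_star N V \<eta> * real n powr (1 / real N)))"
proof -
  note N = assms(1) and sub = assms(2) and cl = assms(3) and reg = assms(4) and eta = assms(5)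
    and x0 = assms(6) and i = assms(7) and lam = assms(8) and start = assms(9)
    and step = assms(10) and \<delta> = assms(11)
  define \<beta> where "\<beta> = beta_star N V \<eta>"
  have kap: "2 \<le> kappa_star N V" by (rule kappa_star_ge_2[OF sub cl reg])
  interpret linearly_regular_family V "{1..N}" "kappa_star N V"
    by (rule linearly_regular_family_kappa_star[OF sub cl reg])
  note eps = eps_star_pos[OF kap] and beta_half = beta_star_ge[OF kap eta, folded \<beta>_def]
  have beta: "0 < \<beta>" "\<beta> < 1" using beta_half beta_star_less_1[OF kap eta] by (auto simp: \<beta>_def)
  have nx0: "0 < norm x\<^sub>0" using x0 by simp
  have pos: "0 < (2 - \<eta>) * norm x\<^sub>0" using eta nx0 by auto
  have nonneg: "0 \<le> \<delta> n" for n unfolding \<delta> using pos by (intro divide_nonneg_nonneg) auto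
  have delta_le: "\<delta> n * norm x\<^sub>0 \<le> infdist (x n) (V (i n))" for n
  proof -
    have "norm (x (Suc n) - x n) = \<bar>lam n\<bar> * infdist (x n) (V (i n))"
      unfolding step by (rule norm_relaxed_proj_diff[OF sub cl, OF i i])
    also have "\<dots> \<le> (2 - \<eta>) * infdist (x n) (V (i n))"
      using lam[of n] eta by (intro mult_right_mono infdist_nonneg) auto
    finally have "norm (x (Suc n) - x n) / (2 - \<eta>) \<le> infdist (x n) (V (i n))"
      using eta by (simp add: divide_le_eq mult.commute)
    moreover have "\<delta> n * norm x\<^sub>0 = norm (x (Suc n) - x n) / (2 - \<eta>)"
      using nx0 by (simp add: \<delta>)
    ultimately show ?thesis by simp
  qed
  have count: "finite {n. s \<le> \<delta> n}" "card {n. s \<le> \<delta> n} < (N + k) choose k"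
    if s: "\<beta> ^ k < s" for s k
  proof -
    have "infdist (x 0) (Inters {1..N}) \<le> norm x\<^sub>0"
      using infdist_le[OF subspace_0[OF subspace_Inters[OF order_refl]], of "x 0"]
      by (simp add: start)
    then have "\<beta> ^ k * infdist (x 0) (Inters {1..N}) \<le> \<beta> ^ k * norm x\<^sub>0"
      using beta by (intro mult_left_mono) auto
    also have "\<dots> < s * norm x\<^sub>0" using s nx0 by simp
    finally have close: "\<beta> ^ k * infdist (x 0) (Inters {1..N}) < s * norm x\<^sub>0" .
    have bound: "card {n. n < L \<and> s \<le> \<delta> n} < (N + k) choose k" for L
    proof -
      have "card {n. n < L \<and> s \<le> \<delta> n}
          \<le> card {n. n < L \<and> s * norm x\<^sub>0 \<le> infdist (x n) (V (i n))}"
        using nx0 by (intro card_mono) (auto intro!: order_trans[OF _ delta_le] mult_right_mono)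
      also have "\<dots> < (card {1..N} + k) choose k"
        using eta eps kappa_star_power_eps_star[OF kap] beta_half
          beta_star_power2[OF kap eta] i lam step close
        by (intro card_large_steps_less_binomial[where \<eta> = \<eta> and \<epsilon> = "eps_star N V" and \<beta> = \<beta>
              and lam = lam]) (auto simp: \<beta>_def)
      finally show ?thesis by simp
    qed
    \<comment> \<open>A bound for all finite stretches of the sequence bounds every finite set of large
        steps, hence their total number.\<close>
    have sub: "F \<subseteq> {n. n < Suc (Max F) \<and> s \<le> \<delta> n}" if "finite F" "F \<subseteq> {n. s \<le> \<delta> n}" for F
      using that by (auto simp: less_Suc_eq_le)
    have small: "card F < (N + k) choose k" if "finite F" "F \<subseteq> {n. s \<le> \<delta> n}" for F
      using card_mono[OF _ sub[OF that]] bound[of "Suc (Max F)"] by simp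
    show fin: "finite {n. s \<le> \<delta> n}"
    proof (rule ccontr)
      assume "infinite {n. s \<le> \<delta> n}"
      then obtain F where "finite F" "card F = (N + k) choose k" "F \<subseteq> {n. s \<le> \<delta> n}"
        by (metis infinite_arbitrarily_large)
      then show False using small[of F] by simp
    qed
    show "card {n. s \<le> \<delta> n} < (N + k) choose k" using small[OF fin order_refl] .
  qed
  have fin: "finite {n. s \<le> \<delta> n}" if "0 < s" for s
    using real_arch_pow_inv[OF that beta(2)] count(1) by blast
  have "decreasing_rearrangement \<delta> n
      < \<beta> powi (- int N) * exp (- (real N / 9 * ln (inverse \<beta>)) * real n powr (1 / real N))" for n
  proof (cases "0 < decreasing_rearrangement \<delta> n")
    case False
    moreover have "0 < \<beta> powi (- int N)" using beta(1) by (rule zero_less_power_int)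
    ultimately show ?thesis by (smt (verit) exp_gt_zero mult_pos_pos)
  next
    case True
    define s where "s = decreasing_rearrangement \<delta> n"
    have ns: "n < card {k. s \<le> \<delta> k}"
      unfolding s_def using nonneg fin True by (rule decreasing_rearrangement_less_card)
    \<comment> \<open>The count applies with strict inequality \<open>\<beta>\<^sup>k < s\<close>; minimality of \<open>k\<close> turns it into an upper
        bound for \<open>s\<close> in terms of \<open>k - 1\<close>.\<close>
    define k where "k = (LEAST k. \<beta> ^ k < s)"
    have "\<exists>k. \<beta> ^ k < s" using True beta(2) unfolding s_def by (rule real_arch_pow_inv)
    then have k: "\<beta> ^ k < s" unfolding k_def by (rule LeastI_ex)
    have "k \<noteq> 0" using count(2)[OF k] ns by (intro notI) simp
    then obtain k' where k': "k = Suc k'" using not0_implies_Suc by blast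
    have "s \<le> \<beta> ^ k'" using not_less_Least[of k' "\<lambda>k. \<beta> ^ k < s"] k' unfolding k_def by simp
    also have "\<dots> < \<beta> powi (- int N) * exp (- (real N / 9 * ln (inverse \<beta>)) * real n powr (1 / real N))"
      using ns count(2)[OF k] k' by (intro power_less_stretched_exp[OF N beta]) simp
    finally show ?thesis unfolding s_def .
  qed
  moreover have "0 < real N / 9 * ln (inverse \<beta>)"
    using N beta by (simp add: one_less_inverse)
  ultimately show ?thesis by (simp add: rho_star_def c_star_def \<beta>_def)
qed

end
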